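(* Let $D$ be a commutative ring with identity, let $M$ be a $D$-module, and put $R=D\ltimes M$. Let $\pi:R\to D$, $\pi(d,m)=d$, be the natural projection. For an ideal $J$ of $R$, define $I=\pi(J)$ and $N=\{m\in M:(0,m)\in J\}$. Then $I$ is an ideal of $D$, $N$ is a $D$-submodule of $M$, and $IM\subseteq N$. Moreover, there is a unique homomorphism $\varphi\in\operatorname{Hom}_D(I,M/N)$ such that $$J=\{(d,m)\in D\ltimes M: d\in I,\ m+N=\varphi(d)\}.$$ Conversely, every triple $(I,N,\varphi)$ in which $I$ is an ideal of $D$, $N$ is a $D$-submodule of $M$, $IM\subseteq N$, and $\varphi\in\operatorname{Hom}_D(I,M/N)$ determines an ideal $$J_\varphi=\{(d,m)\in D\ltimes M: d\in I,\ m+N=\varphi(d)\}$$ of $R$. Furthermore, $\pi(J_\varphi)=I$. Thus the ideals of $D\ltimes M$ are in bijection with the triples $(I,N,\varphi)$ satisfying these conditions.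
   Context: For a commutative ring $D$ with identity and a $D$-module $M$, the idealization $D\ltimes M$ is the commutative ring whose additive group is $D\oplus M$ and whose multiplication is $(d,m)(d',m')=(dd',dm'+d'm)$. For an ideal $I$ of $D$, $IM$ denotes the submodule of $M$ generated by all products $dx$ with $d\in I$, $x\in M$. $\operatorname{Hom}_D(I,M/N)$ is the set of $D$-module homomorphisms $I\to M/N$. *)

theory Defs
  imports "HOL-Algebra.Module" "HOL-Algebra.QuotRing"
begin

definition idealization ::
    "('a, 'c) ring_scheme \<Rightarrow> ('a, 'b, 'd) module_scheme \<Rightarrow> ('a \<times> 'b) ring"
  where "idealization D M =
    \<lparr>carrier = carrier D \<times> carrier M,
     mult = (\<lambda>(d, m) (d', m'). (d \<otimes>\<^bsub>D\<^esub> d', (d \<odot>\<^bsub>M\<^esub> m') \<oplus>\<^bsub>M\<^esub> (d' \<odot>\<^bsub>M\<^esub> m))),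
     one = (\<one>\<^bsub>D\<^esub>, \<zero>\<^bsub>M\<^esub>),
     zero = (\<zero>\<^bsub>D\<^esub>, \<zero>\<^bsub>M\<^esub>),
     add = (\<lambda>(d, m) (d', m'). (d \<oplus>\<^bsub>D\<^esub> d', m \<oplus>\<^bsub>M\<^esub> m'))\<rparr>"

text \<open>
  The record type of modules extends that of rings, but the locale \<^locale>\<open>module\<close> does not
  constrain the fields \<open>mult\<close> and \<open>one\<close> of a module; they are junk below.
\<close>

definition ideal_module :: "('a, 'c) ring_scheme \<Rightarrow> 'a set \<Rightarrow> ('a, 'a) module"
  where "ideal_module D I =
    \<lparr>carrier = I, mult = undefined, one = undefined, zero = \<zero>\<^bsub>D\<^esub>, add = add D,
     smult = mult D\<rparr>"

text \<open>
  The elements of \<open>M/N\<close> are the cosets \<open>m + N\<close>, written \<open>N +> m\<close> in the library. When \<open>N\<close> is a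
  submodule, the union in the scalar multiplication is the single coset \<open>a x + N\<close>, for any \<open>x\<close>
  in \<open>X\<close>.
\<close>

definition quot_module :: "('a, 'b, 'd) module_scheme \<Rightarrow> 'b set \<Rightarrow> ('a, 'b set) module"
  where "quot_module M N =
    \<lparr>carrier = a_rcosets\<^bsub>M\<^esub> N, mult = undefined, one = undefined, zero = N, add = set_add M,
     smult = (\<lambda>a X. \<Union>x\<in>X. N +>\<^bsub>M\<^esub> (a \<odot>\<^bsub>M\<^esub> x))\<rparr>"

text \<open>
  Homomorphisms are extensional, i.e. \<open>undefined\<close> outside the carrier of the domain, so that
  equality of HOL functions is equality of homomorphisms.
\<close>

definition module_hom ::
    "('a, 'c) ring_scheme \<Rightarrow> ('a, 'b, 'd) module_scheme \<Rightarrow> ('a, 'e, 'f) module_scheme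
      \<Rightarrow> ('b \<Rightarrow> 'e) set"
  where "module_hom D A B =
    {f \<in> carrier A \<rightarrow>\<^sub>E carrier B.
      (\<forall>x\<in>carrier A. \<forall>y\<in>carrier A. f (x \<oplus>\<^bsub>A\<^esub> y) = f x \<oplus>\<^bsub>B\<^esub> f y) \<and>
      (\<forall>a\<in>carrier D. \<forall>x\<in>carrier A. f (a \<odot>\<^bsub>A\<^esub> x) = a \<odot>\<^bsub>B\<^esub> f x)}"

definition ideal_smult ::
    "('a, 'c) ring_scheme \<Rightarrow> ('a, 'b, 'd) module_scheme \<Rightarrow> 'a set \<Rightarrow> 'b set"
  where "ideal_smult D M I =
    \<Inter>{K. submodule K D M \<and> {d \<odot>\<^bsub>M\<^esub> x | d x. d \<in> I \<and> x \<in> carrier M} \<subseteq> K}"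

definition ideal_triples ::
    "('a, 'c) ring_scheme \<Rightarrow> ('a, 'b, 'd) module_scheme
      \<Rightarrow> ('a set \<times> 'b set \<times> ('a \<Rightarrow> 'b set)) set"
  where "ideal_triples D M =
    {(I, N, \<phi>). ideal I D \<and> submodule N D M \<and> ideal_smult D M I \<subseteq> N \<and>
      \<phi> \<in> module_hom D (ideal_module D I) (quot_module M N)}"

definition triple_ideal ::
    "('a, 'c) ring_scheme \<Rightarrow> ('a, 'b, 'd) module_scheme \<Rightarrow> 'a set \<Rightarrow> 'b set \<Rightarrow> ('a \<Rightarrow> 'b set)
      \<Rightarrow> ('a \<times> 'b) set"
  where "triple_ideal D M I N \<phi> =
    {(d, m) \<in> carrier (idealization D M). d \<in> I \<and> N +>\<^bsub>M\<^esub> m = \<phi> d}"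

lemma idealization_cring:
  assumes "module D M"
  shows "cring (idealization D M)"
proof -
  interpret module D M by fact
  have "\<exists>y\<in>carrier D \<times> carrier M. y \<oplus>\<^bsub>idealization D M\<^esub> x = (\<zero>\<^bsub>D\<^esub>, \<zero>\<^bsub>M\<^esub>)"
    if "x \<in> carrier D \<times> carrier M" for x
    using that
    by (intro bexI[of _ "(\<ominus>\<^bsub>D\<^esub> fst x, \<ominus>\<^bsub>M\<^esub> snd x)"])
      (auto simp: idealization_def R.l_neg M.l_neg)
  then have "abelian_group (idealization D M)"
    by (intro abelian_groupI) (auto simp: idealization_def R.a_ac M.a_ac)
  moreover have "comm_monoid (idealization D M)"
    by (intro comm_monoidI)
      (auto simp: idealization_def R.m_ac M.a_ac smult_r_distr smult_assoc1[symmetric])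
  ultimately show ?thesis
    by (intro cringI)
      (auto simp: idealization_def R.l_distr M.a_ac smult_l_distr smult_r_distr)
qed

lemma ideal_module_module:
  assumes "cring D" "ideal I D"
  shows "module D (ideal_module D I)"
proof -
  interpret cring D by fact
  interpret I: ideal I D by fact
  have sub: "\<And>x. x \<in> I \<Longrightarrow> x \<in> carrier D"
    by (rule I.Icarr)
  have "\<exists>y\<in>I. y \<oplus>\<^bsub>D\<^esub> x = \<zero>\<^bsub>D\<^esub>" if "x \<in> I" for x
    using that sub l_neg by blast
  then have "abelian_group (ideal_module D I)"
    by (intro abelian_groupI) (auto simp: ideal_module_def sub a_ac)
  then show ?thesis
    using assms(1)
    by (intro moduleI)
      (auto simp: ideal_module_def sub l_distr r_distr m_assoc I.I_l_closed)
qed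

lemma quot_module_smult:
  assumes "module D M" "submodule N D M" "a \<in> carrier D" "x \<in> carrier M"
  shows "a \<odot>\<^bsub>quot_module M N\<^esub> (N +>\<^bsub>M\<^esub> x) = N +>\<^bsub>M\<^esub> (a \<odot>\<^bsub>M\<^esub> x)"
proof -
  interpret module D M by fact
  interpret N: submodule N D M by fact
  interpret N: abelian_subgroup N M
    by (intro abelian_subgroupI3 additive_subgroupI N.subgroup_axioms M.abelian_group_axioms)
  have sub: "\<And>x. x \<in> N \<Longrightarrow> x \<in> carrier M"
    by (rule N.a_Hcarr)
  have "N +>\<^bsub>M\<^esub> (a \<odot>\<^bsub>M\<^esub> y) = N +>\<^bsub>M\<^esub> (a \<odot>\<^bsub>M\<^esub> x)" if "y \<in> N +>\<^bsub>M\<^esub> x" for y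
  proof -
    from that obtain n where n: "n \<in> N" "y = n \<oplus>\<^bsub>M\<^esub> x"
      by (auto simp: a_r_coset_def')
    then have "a \<odot>\<^bsub>M\<^esub> y \<in> N +>\<^bsub>M\<^esub> (a \<odot>\<^bsub>M\<^esub> x)"
      using assms sub by (auto simp: a_r_coset_def' smult_r_distr)
    then show ?thesis
      using assms M.a_repr_independence[OF _ _ N.a_subgroup] by simp
  qed
  moreover have "x \<in> N +>\<^bsub>M\<^esub> x"
    using assms N.a_rcos_self by blast
  ultimately have "(\<Union>y\<in>N +>\<^bsub>M\<^esub> x. N +>\<^bsub>M\<^esub> (a \<odot>\<^bsub>M\<^esub> y)) = N +>\<^bsub>M\<^esub> (a \<odot>\<^bsub>M\<^esub> x)"
    by blast
  then show ?thesis
    by (simp add: quot_module_def)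
qed

lemma quot_module_module:
  assumes "module D M" "submodule N D M"
  shows "module D (quot_module M N)"
proof -
  interpret module D M by fact
  interpret N: submodule N D M by fact
  interpret N: abelian_subgroup N M
    by (intro abelian_subgroupI3 additive_subgroupI N.subgroup_axioms M.abelian_group_axioms)
  have car: "X \<in> carrier (quot_module M N) \<longleftrightarrow> (\<exists>x\<in>carrier M. X = N +>\<^bsub>M\<^esub> x)" for X
    by (auto simp: quot_module_def A_RCOSETS_def')
  have add: "(N +>\<^bsub>M\<^esub> x) \<oplus>\<^bsub>quot_module M N\<^esub> (N +>\<^bsub>M\<^esub> y) = N +>\<^bsub>M\<^esub> (x \<oplus>\<^bsub>M\<^esub> y)"
    if "x \<in> carrier M" "y \<in> carrier M" for x y
    using that N.a_rcos_sum by (simp add: quot_module_def)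
  have zero: "\<zero>\<^bsub>quot_module M N\<^esub> = N +>\<^bsub>M\<^esub> \<zero>\<^bsub>M\<^esub>"
    using M.a_coset_add_zero[OF N.a_subset] by (simp add: quot_module_def)
  note smult = quot_module_smult[OF assms]
  have inv: "\<exists>y\<in>carrier (quot_module M N). y \<oplus>\<^bsub>quot_module M N\<^esub> X = \<zero>\<^bsub>quot_module M N\<^esub>"
    if "X \<in> carrier (quot_module M N)" for X
  proof -
    from that obtain x where "x \<in> carrier M" "X = N +>\<^bsub>M\<^esub> x"
      by (auto simp: car)
    then show ?thesis
      by (intro bexI[of _ "N +>\<^bsub>M\<^esub> (\<ominus>\<^bsub>M\<^esub> x)"]) (auto simp: car add zero M.l_neg)
  qed
  have "abelian_group (quot_module M N)"
  proof (rule abelian_groupI)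
    show "\<zero>\<^bsub>quot_module M N\<^esub> \<in> carrier (quot_module M N)"
      unfolding car zero by blast
  next
    fix X assume "X \<in> carrier (quot_module M N)"
    then show "\<zero>\<^bsub>quot_module M N\<^esub> \<oplus>\<^bsub>quot_module M N\<^esub> X = X"
      unfolding zero by (auto simp: car add)
  qed (fact inv | (auto simp: car add M.a_ac; blast intro: M.a_closed))+
  then show ?thesis
    using R.is_cring
    by (intro moduleI)
      (auto simp: car add smult smult_l_distr smult_r_distr smult_assoc1; blast?)+
qed

end

theory Submission
  imports Defs
begin

text \<open>
  The fibre of an ideal \<open>J\<close> of \<open>D \<ltimes> M\<close> over \<open>d \<in> I\<close> is a coset of the fibre \<open>N\<close> over \<open>0\<close>, and
  \<open>\<phi>\<close> sends \<open>d\<close> to this fibre. Conversely the fibre of \<open>J\<^sub>\<phi>\<close> over \<open>d \<in> I\<close>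
  is the coset \<open>\<phi> d\<close> itself, so \<open>J\<^sub>\<phi>\<close> determines the triple.
\<close>

section \<open>Closure criteria for ideals and submodules\<close>

lemma (in cring) idealI_mult_closed:
  assumes "J \<subseteq> carrier R" "J \<noteq> {}"
    and add: "\<And>x y. x \<in> J \<Longrightarrow> y \<in> J \<Longrightarrow> x \<oplus> y \<in> J"
    and mult: "\<And>a x. a \<in> carrier R \<Longrightarrow> x \<in> J \<Longrightarrow> a \<otimes> x \<in> J"
  shows "ideal J R"
proof (rule idealI[OF ring_axioms])
  \<comment> \<open>Negatives come for free from closure under multiplication: -x = (-1) x.\<close>
  have "\<ominus> x \<in> J" if "x \<in> J" for x
    using mult[OF _ that, of "\<ominus> \<one>"] that assms(1) by (auto simp: l_minus)
  then show "subgroup J (add_monoid R)"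
    using assms by (intro add.subgroupI) auto
  fix a x assume "a \<in> J" "x \<in> carrier R"
  then show "x \<otimes> a \<in> J"
    by (intro mult)
  then show "a \<otimes> x \<in> J"
    using \<open>a \<in> J\<close> \<open>x \<in> carrier R\<close> assms(1) by (metis m_comm subsetD)
qed

context module
begin

lemma submoduleI_smult_closed:
  assumes "N \<subseteq> carrier M" "N \<noteq> {}"
    and add: "\<And>x y. x \<in> N \<Longrightarrow> y \<in> N \<Longrightarrow> x \<oplus>\<^bsub>M\<^esub> y \<in> N"
    and smult: "\<And>a x. a \<in> carrier R \<Longrightarrow> x \<in> N \<Longrightarrow> a \<odot>\<^bsub>M\<^esub> x \<in> N"
  shows "submodule N R M"
proof (rule submodule.intro)
  \<comment> \<open>Again -x = (-1) x, now with -1 acting as a scalar.\<close>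
  have "\<ominus>\<^bsub>M\<^esub> x \<in> N" if "x \<in> N" for x
    using smult[OF _ that, of "\<ominus> \<one>"] that assms(1) by (auto simp: smult_l_minus)
  then show "subgroup N (add_monoid M)"
    using assms by (intro M.add.subgroupI) (auto simp: a_inv_def)
qed (unfold_locales, rule smult)

section \<open>Cosets of submodules, the submodule IM and the quotient M/N\<close>

lemma submodule_abelian_subgroup:
  assumes "submodule N R M"
  shows "abelian_subgroup N M"
  using submodule.axioms(1)[OF assms] M.abelian_group_axioms
  by (intro abelian_subgroupI3 additive_subgroupI)

lemma submodule_rcos_eq_iff:
  assumes "submodule N R M" "x \<in> carrier M" "y \<in> carrier M"
  shows "N +>\<^bsub>M\<^esub> x = N +>\<^bsub>M\<^esub> y \<longleftrightarrow> x \<in> N +>\<^bsub>M\<^esub> y"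
proof -
  interpret N: abelian_subgroup N M
    by (rule submodule_abelian_subgroup[OF assms(1)])
  show ?thesis
    using assms N.a_rcos_self M.a_repr_independence[OF _ _ N.a_subgroup] by metis
qed

text \<open>Since N is a submodule, it is one of the sets in the intersection defining
  \<open>ideal_smult\<close> as soon as it contains the generators. Hence the inclusion can be
  tested on single products.\<close>

lemma ideal_smult_subset_iff:
  assumes "submodule N R M"
  shows "ideal_smult R M I \<subseteq> N \<longleftrightarrow> (\<forall>d\<in>I. \<forall>x\<in>carrier M. d \<odot>\<^bsub>M\<^esub> x \<in> N)"
proof
  assume "ideal_smult R M I \<subseteq> N"
  moreover have "{d \<odot>\<^bsub>M\<^esub> x | d x. d \<in> I \<and> x \<in> carrier M} \<subseteq> ideal_smult R M I"
    unfolding ideal_smult_def by blast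
  ultimately show "\<forall>d\<in>I. \<forall>x\<in>carrier M. d \<odot>\<^bsub>M\<^esub> x \<in> N"
    by blast
next
  assume "\<forall>d\<in>I. \<forall>x\<in>carrier M. d \<odot>\<^bsub>M\<^esub> x \<in> N"
  then show "ideal_smult R M I \<subseteq> N"
    using assms unfolding ideal_smult_def by blast
qed

lemma quot_module_add_rcos:
  assumes "submodule N R M" "x \<in> carrier M" "y \<in> carrier M"
  shows "(N +>\<^bsub>M\<^esub> x) \<oplus>\<^bsub>quot_module M N\<^esub> (N +>\<^bsub>M\<^esub> y) = N +>\<^bsub>M\<^esub> (x \<oplus>\<^bsub>M\<^esub> y)"
proof -
  interpret N: abelian_subgroup N M
    by (rule submodule_abelian_subgroup[OF assms(1)])
  show ?thesis
    using assms N.a_rcos_sum by (simp add: quot_module_def)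
qed

lemma carrier_quot_module_iff:
  "X \<in> carrier (quot_module M N) \<longleftrightarrow> (\<exists>x\<in>carrier M. X = N +>\<^bsub>M\<^esub> x)"
  by (auto simp: quot_module_def A_RCOSETS_def')

section \<open>From an ideal J to its triple\<close>

lemma ideal_idealizationD:
  assumes "ideal J (idealization R M)"
  shows "J \<subseteq> carrier R \<times> carrier M"
    and "(\<zero>, \<zero>\<^bsub>M\<^esub>) \<in> J"
    and "\<And>d d' m m'. (d, m) \<in> J \<Longrightarrow> (d', m') \<in> J \<Longrightarrow> (d \<oplus> d', m \<oplus>\<^bsub>M\<^esub> m') \<in> J"
    and "\<And>a d m. a \<in> carrier R \<Longrightarrow> (d, m) \<in> J \<Longrightarrow> (a \<otimes> d, a \<odot>\<^bsub>M\<^esub> m) \<in> J"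
    and "\<And>d m x. (d, m) \<in> J \<Longrightarrow> x \<in> carrier M \<Longrightarrow> (\<zero>, d \<odot>\<^bsub>M\<^esub> x) \<in> J"
proof -
  interpret J: ideal J "idealization R M" by fact
  show sub: "J \<subseteq> carrier R \<times> carrier M"
    using J.a_subset by (simp add: idealization_def)
  show "(\<zero>, \<zero>\<^bsub>M\<^esub>) \<in> J"
    using additive_subgroup.zero_closed[OF J.additive_subgroup_axioms]
    by (simp add: idealization_def)
  show "(d \<oplus> d', m \<oplus>\<^bsub>M\<^esub> m') \<in> J" if "(d, m) \<in> J" "(d', m') \<in> J" for d d' m m'
    using additive_subgroup.a_closed[OF J.additive_subgroup_axioms that]
    by (simp add: idealization_def)
  show "(a \<otimes> d, a \<odot>\<^bsub>M\<^esub> m) \<in> J" if "a \<in> carrier R" "(d, m) \<in> J" for a d m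
  proof -
    have "d \<in> carrier R" "m \<in> carrier M"
      using that sub by auto
    then show ?thesis
      \<comment> \<open>The ring D acts on J through the elements (a, 0): (a, 0)(d, m) = (ad, am +
        d0) = (ad, am).\<close>
      using J.I_l_closed[OF that(2), of "(a, \<zero>\<^bsub>M\<^esub>)"] that(1)
      by (simp add: idealization_def smult_r_null)
  qed
  show "(\<zero>, d \<odot>\<^bsub>M\<^esub> x) \<in> J" if "(d, m) \<in> J" "x \<in> carrier M" for d m x
  proof -
    have "d \<in> carrier R" "m \<in> carrier M"
      using that sub by auto
    then show ?thesis
      \<comment> \<open>Multiplication by (0, x) moves d into the module component and kills m: (0,
        x)(d, m) = (0, 0m + dx) = (0, dx).\<close>
      using J.I_l_closed[OF that(1), of "(\<zero>, x)"] that(2) by (simp add: idealization_def)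
  qed
qed

lemma ideal_fst_image:
  assumes "ideal J (idealization R M)"
  shows "ideal (fst ` J) R"
proof (rule idealI_mult_closed)
  note J = ideal_idealizationD[OF assms]
  show "fst ` J \<subseteq> carrier R" "fst ` J \<noteq> {}"
    using J(1,2) by auto
  show "x \<oplus> y \<in> fst ` J" if "x \<in> fst ` J" "y \<in> fst ` J" for x y
    using that J(3) by force
  show "a \<otimes> x \<in> fst ` J" if "a \<in> carrier R" "x \<in> fst ` J" for a x
    using that J(4) by force
qed

lemma submodule_zero_fibre:
  assumes "ideal J (idealization R M)"
  shows "submodule {m \<in> carrier M. (\<zero>, m) \<in> J} R M"
proof (rule submoduleI_smult_closed)
  note J = ideal_idealizationD[OF assms]
  let ?N = "{m \<in> carrier M. (\<zero>, m) \<in> J}"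
  show "?N \<noteq> {}"
    using J(2) by auto
  show "x \<oplus>\<^bsub>M\<^esub> y \<in> ?N" if "x \<in> ?N" "y \<in> ?N" for x y
    using that J(3)[of \<zero> x \<zero> y] by simp
  show "a \<odot>\<^bsub>M\<^esub> x \<in> ?N" if "a \<in> carrier R" "x \<in> ?N" for a x
    using that J(4)[of a \<zero> x] by simp
qed auto

text \<open>Each d in the projection of J has a lift (d, m) in J, and the product of this lift with
  (0, x) is (0, dx). So dx lies in the fibre over 0, whichever lift was taken.\<close>

lemma ideal_smult_fst_image_subset:
  assumes "ideal J (idealization R M)"
  shows "ideal_smult R M (fst ` J) \<subseteq> {m \<in> carrier M. (\<zero>, m) \<in> J}"
  unfolding ideal_smult_subset_iff[OF submodule_zero_fibre[OF assms]]
  using ideal_idealizationD(1,5)[OF assms] by auto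

text \<open>Two elements of J over the same d differ by an element of J over 0, and adding an
  element over 0 does not change d.\<close>

lemma ideal_fibre_eq_rcos:
  assumes "ideal J (idealization R M)" "(d, m) \<in> J"
  shows "J `` {d} = {m \<in> carrier M. (\<zero>, m) \<in> J} +>\<^bsub>M\<^esub> m"
proof (intro equalityI subsetI)
  note J = ideal_idealizationD[OF assms(1)]
  have dm: "d \<in> carrier R" "m \<in> carrier M"
    using assms(2) J(1) by auto
  {
    fix x assume "x \<in> J `` {d}"
    then have dx: "(d, x) \<in> J" by simp
    then have x: "x \<in> carrier M"
      using J(1) by auto
    \<comment> \<open>The negative of (d, m) is its multiple by -1; adding it to (d, x) gives (0, x
      - m).\<close>
    have "(\<ominus> d, \<ominus>\<^bsub>M\<^esub> m) \<in> J"
      using J(4)[OF _ assms(2), of "\<ominus> \<one>"] dm by (simp add: R.l_minus smult_l_minus)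
    then have "(\<zero>, x \<oplus>\<^bsub>M\<^esub> \<ominus>\<^bsub>M\<^esub> m) \<in> J"
      using J(3)[OF dx] dm by (metis R.r_neg)
    moreover have "x = x \<oplus>\<^bsub>M\<^esub> \<ominus>\<^bsub>M\<^esub> m \<oplus>\<^bsub>M\<^esub> m"
      using x dm by (simp add: M.a_assoc M.l_neg)
    ultimately show "x \<in> {m \<in> carrier M. (\<zero>, m) \<in> J} +>\<^bsub>M\<^esub> m"
      using x dm unfolding a_r_coset_def' by blast
  next
    fix x assume "x \<in> {m \<in> carrier M. (\<zero>, m) \<in> J} +>\<^bsub>M\<^esub> m"
    then obtain n where "(\<zero>, n) \<in> J" "x = n \<oplus>\<^bsub>M\<^esub> m"
      by (auto simp: a_r_coset_def')
    then show "x \<in> J `` {d}"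
      using J(3)[OF _ assms(2), of \<zero> n] dm by simp
  }
qed

text \<open>Taking the whole fibre as the value avoids choosing lifts, and any lift (d, m) in J
  computes that value as the coset of m. A sum of lifts is a lift of the sum and a scaled lift is a
  lift of the scaled element, which gives linearity. Restricting to the projection of J makes the
  map extensional, as \<open>module_hom\<close> demands.\<close>

lemma fibre_in_module_hom:
  assumes "ideal J (idealization R M)"
  shows "(\<lambda>d\<in>fst ` J. J `` {d}) \<in>
    module_hom R (ideal_module R (fst ` J)) (quot_module M {m \<in> carrier M. (\<zero>, m) \<in> J})"
    (is "?\<phi> \<in> module_hom R (ideal_module R ?I) (quot_module M ?N)")
proof -
  note J = ideal_idealizationD[OF assms]
  note N = submodule_zero_fibre[OF assms]
  have \<phi>: "?\<phi> d = ?N +>\<^bsub>M\<^esub> m" if "(d, m) \<in> J" for d m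
    using ideal_fibre_eq_rcos[OF assms that] that by force
  have "?\<phi> x \<in> carrier (quot_module M ?N)" if x: "x \<in> ?I" for x
  proof -
    from x obtain m where m: "(x, m) \<in> J"
      by auto
    then show ?thesis
      using J(1) \<phi>[OF m] unfolding carrier_quot_module_iff by blast
  qed
  moreover have "?\<phi> (x \<oplus> y) = ?\<phi> x \<oplus>\<^bsub>quot_module M ?N\<^esub> ?\<phi> y"
    if xy: "x \<in> ?I" "y \<in> ?I" for x y
  proof -
    from xy obtain m n where mn: "(x, m) \<in> J" "(y, n) \<in> J"
      by auto
    then have "m \<in> carrier M" "n \<in> carrier M"
      using J(1) by auto
    then show ?thesis
      unfolding \<phi>[OF mn(1)] \<phi>[OF mn(2)] \<phi>[OF J(3)[OF mn]]
      by (rule quot_module_add_rcos[OF N, symmetric])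
  qed
  moreover have "?\<phi> (a \<otimes> x) = a \<odot>\<^bsub>quot_module M ?N\<^esub> ?\<phi> x"
    if a: "a \<in> carrier R" and x: "x \<in> ?I" for a x
  proof -
    from x obtain m where m: "(x, m) \<in> J"
      by auto
    then have "m \<in> carrier M"
      using J(1) by auto
    then show ?thesis
      unfolding \<phi>[OF m] \<phi>[OF J(4)[OF a m]]
      by (rule quot_module_smult[OF module_axioms N a, symmetric])
  qed
  moreover have "?\<phi> \<in> extensional ?I"
    by (rule restrict_extensional)
  ultimately show ?thesis
    by (simp add: module_hom_def ideal_module_def PiE_iff del: restrict_apply)
qed

lemma ideal_eq_triple_ideal_fibre:
  assumes "ideal J (idealization R M)"
  shows "J = triple_ideal R M (fst ` J) {m \<in> carrier M. (\<zero>, m) \<in> J} (\<lambda>d\<in>fst ` J. J `` {d})"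
    (is "J = triple_ideal R M ?I ?N ?\<phi>")
proof (intro equalityI subsetI)
  note J = ideal_idealizationD[OF assms]
  note N = submodule_zero_fibre[OF assms]
  {
    fix p assume "p \<in> J"
    then obtain d m where p: "p = (d, m)" and dm: "(d, m) \<in> J"
      by (cases p) simp
    have "d \<in> carrier R" "m \<in> carrier M"
      using dm J(1) by auto
    moreover have "d \<in> ?I"
      using dm by (rule image_eqI[rotated]) simp
    ultimately show "p \<in> triple_ideal R M ?I ?N ?\<phi>"
      using ideal_fibre_eq_rcos[OF assms dm] by (simp add: p triple_ideal_def idealization_def)
  next
    fix p assume "p \<in> triple_ideal R M ?I ?N ?\<phi>"
    moreover obtain d m where p: "p = (d, m)"
      by (cases p)
    ultimately have "m \<in> carrier M" "?N +>\<^bsub>M\<^esub> m = J `` {d}"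
      by (simp_all add: triple_ideal_def idealization_def)
    \<comment> \<open>The element m belongs to its own coset, and that coset is the fibre of J over
      d.\<close>
    then have "m \<in> J `` {d}"
      using abelian_subgroup.a_rcos_self[OF submodule_abelian_subgroup[OF N], of m] by simp
    then show "p \<in> J"
      by (simp add: p)
  }
qed

section \<open>From a triple to its ideal, and back to the triple\<close>

context
  fixes I N \<phi>
  assumes I: "ideal I R" and N: "submodule N R M"
    and IM: "ideal_smult R M I \<subseteq> N"
    and \<phi>: "\<phi> \<in> module_hom R (ideal_module R I) (quot_module M N)"
begin

lemma triple_ideal_iff:
  "(d, m) \<in> triple_ideal R M I N \<phi> \<longleftrightarrow> d \<in> I \<and> m \<in> carrier M \<and> N +>\<^bsub>M\<^esub> m = \<phi> d"
  using ideal.Icarr[OF I] by (auto simp: triple_ideal_def idealization_def)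

lemma triple_hom_add: "x \<in> I \<Longrightarrow> y \<in> I \<Longrightarrow> \<phi> (x \<oplus> y) = \<phi> x \<oplus>\<^bsub>quot_module M N\<^esub> \<phi> y"
  using \<phi> by (auto simp: module_hom_def ideal_module_def)

lemma triple_hom_smult:
  "a \<in> carrier R \<Longrightarrow> x \<in> I \<Longrightarrow> \<phi> (a \<otimes> x) = a \<odot>\<^bsub>quot_module M N\<^esub> \<phi> x"
  using \<phi> by (auto simp: module_hom_def ideal_module_def)

lemma triple_hom_rcos:
  assumes "d \<in> I"
  obtains m where "m \<in> carrier M" "\<phi> d = N +>\<^bsub>M\<^esub> m"
proof -
  have "\<phi> d \<in> carrier (quot_module M N)"
    using \<phi> assms by (auto simp: module_hom_def ideal_module_def)
  then show ?thesis
    using that unfolding carrier_quot_module_iff by blast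
qed

text \<open>Each value of \<open>\<phi>\<close> on I is a coset, and any representative m of the
  coset \<open>\<phi> d\<close> gives a lift (d, m).\<close>

lemma fst_triple_ideal: "fst ` triple_ideal R M I N \<phi> = I"
proof
  show "I \<subseteq> fst ` triple_ideal R M I N \<phi>"
  proof
    fix d assume "d \<in> I"
    then obtain m where "m \<in> carrier M" "\<phi> d = N +>\<^bsub>M\<^esub> m"
      by (rule triple_hom_rcos)
    then have "(d, m) \<in> triple_ideal R M I N \<phi>"
      using \<open>d \<in> I\<close> by (simp add: triple_ideal_iff)
    then show "d \<in> fst ` triple_ideal R M I N \<phi>"
      by force
  qed
qed (auto simp: triple_ideal_def)

text \<open>The defining condition says that the coset of m equals \<open>\<phi> d\<close>, which
  amounts to m being an element of the coset \<open>\<phi> d\<close>.\<close>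

lemma triple_ideal_fibre:
  assumes "d \<in> I"
  shows "triple_ideal R M I N \<phi> `` {d} = \<phi> d"
proof -
  interpret N: abelian_subgroup N M
    by (rule submodule_abelian_subgroup[OF N])
  obtain x where x: "x \<in> carrier M" "\<phi> d = N +>\<^bsub>M\<^esub> x"
    using assms by (rule triple_hom_rcos)
  \<comment> \<open>The fibre contains only elements of M, so the same must be known of the coset
    \<open>\<phi> d\<close>.\<close>
  then have "N +>\<^bsub>M\<^esub> x \<subseteq> carrier M"
    using M.a_r_coset_subset_G[OF N.a_subset] by blast
  then show ?thesis
    using assms x submodule_rcos_eq_iff[OF N _ x(1)] by (auto simp: triple_ideal_iff)
qed

lemma triple_ideal_zero_fibre: "{m \<in> carrier M. (\<zero>, m) \<in> triple_ideal R M I N \<phi>} = N"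
proof -
  interpret I: ideal I R by (rule I)
  interpret N: abelian_subgroup N M
    by (rule submodule_abelian_subgroup[OF N])
  have zero: "\<zero> \<in> I"
    by (rule additive_subgroup.zero_closed[OF ideal.axioms(1)[OF I]])
  obtain x where x: "x \<in> carrier M" "\<phi> \<zero> = N +>\<^bsub>M\<^esub> x"
    using zero by (rule triple_hom_rcos)
  \<comment> \<open>Linearity for the scalar 0 forces \<open>\<phi>\<close> to send 0 to the zero
    coset N, so the fibre over 0 is N.\<close>
  have "\<phi> \<zero> = \<zero> \<odot>\<^bsub>quot_module M N\<^esub> \<phi> \<zero>"
    using triple_hom_smult[OF R.zero_closed zero] by simp
  also have "\<dots> = N"
    using x M.a_coset_add_zero[OF N.a_subset]
    by (simp add: quot_module_smult[OF module_axioms N] smult_l_null)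
  finally have "triple_ideal R M I N \<phi> `` {\<zero>} = N"
    using triple_ideal_fibre[OF zero] by simp
  then show ?thesis
    using N.a_subset by blast
qed

text \<open>Closure under addition is additivity of \<open>\<phi>\<close>. For (a, x)(d, m) = (ad,
  am + dx), the term dx lies in IM and hence in N, so it vanishes modulo N. What remains is the
  coset of am, which is a times \<open>\<phi> d\<close>, that is \<open>\<phi>\<close> at
  ad.\<close>

lemma ideal_triple_ideal: "ideal (triple_ideal R M I N \<phi>) (idealization R M)"
proof -
  interpret I: ideal I R by (rule I)
  interpret N: abelian_subgroup N M
    by (rule submodule_abelian_subgroup[OF N])
  have zero: "\<zero> \<in> I"
    by (rule additive_subgroup.zero_closed[OF ideal.axioms(1)[OF I]])
  let ?J = "triple_ideal R M I N \<phi>"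
  show ?thesis
  proof (rule cring.idealI_mult_closed[OF idealization_cring[OF module_axioms]])
    show "?J \<subseteq> carrier (idealization R M)"
      by (auto simp: triple_ideal_def)
    show "?J \<noteq> {}"
      using fst_triple_ideal zero by (metis empty_iff image_empty)
  next
    fix p q assume "p \<in> ?J" "q \<in> ?J"
    then obtain d m d' m' where pq: "p = (d, m)" "q = (d', m')" and d: "d \<in> I" "d' \<in> I"
      and m: "m \<in> carrier M" "m' \<in> carrier M" and eq: "N +>\<^bsub>M\<^esub> m = \<phi> d" "N +>\<^bsub>M\<^esub> m' = \<phi> d'"
      by (cases p; cases q) (auto simp: triple_ideal_iff)
    have "N +>\<^bsub>M\<^esub> (m \<oplus>\<^bsub>M\<^esub> m') = \<phi> (d \<oplus> d')"
      unfolding triple_hom_add[OF d] eq[symmetric] quot_module_add_rcos[OF N m] ..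
    moreover have "d \<oplus> d' \<in> I"
      using d by (rule additive_subgroup.a_closed[OF ideal.axioms(1)[OF I]])
    ultimately show "p \<oplus>\<^bsub>idealization R M\<^esub> q \<in> ?J"
      using m by (simp add: pq triple_ideal_iff idealization_def)
  next
    fix p q assume "p \<in> carrier (idealization R M)" and q: "q \<in> ?J"
    then obtain a x where p: "p = (a, x)" "a \<in> carrier R" "x \<in> carrier M"
      by (auto simp: idealization_def)
    obtain d m where dm: "q = (d, m)" "d \<in> I" "m \<in> carrier M" "N +>\<^bsub>M\<^esub> m = \<phi> d"
      using q by (cases q) (auto simp: triple_ideal_iff)
    have "d \<in> carrier R"
      using dm by (simp add: I.Icarr)
    have dx: "d \<odot>\<^bsub>M\<^esub> x \<in> N"
      using IM dm p by (simp add: ideal_smult_subset_iff[OF N])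
    have am: "a \<odot>\<^bsub>M\<^esub> m \<in> carrier M" "d \<odot>\<^bsub>M\<^esub> x \<in> carrier M"
      using p dm \<open>d \<in> carrier R\<close> by simp_all
    \<comment> \<open>Adding dx, an element of N, does not leave the coset of am.\<close>
    have "a \<odot>\<^bsub>M\<^esub> m \<oplus>\<^bsub>M\<^esub> d \<odot>\<^bsub>M\<^esub> x \<in> N +>\<^bsub>M\<^esub> (a \<odot>\<^bsub>M\<^esub> m)"
      using M.a_rcosI[OF dx N.a_subset am(1)] M.a_comm[OF am] by simp
    then have "N +>\<^bsub>M\<^esub> (a \<odot>\<^bsub>M\<^esub> m \<oplus>\<^bsub>M\<^esub> d \<odot>\<^bsub>M\<^esub> x) = N +>\<^bsub>M\<^esub> (a \<odot>\<^bsub>M\<^esub> m)"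
      using am by (simp add: submodule_rcos_eq_iff[OF N])
    also have "\<dots> = \<phi> (a \<otimes> d)"
      unfolding triple_hom_smult[OF p(2) dm(2)] dm(4)[symmetric]
        quot_module_smult[OF module_axioms N p(2) dm(3)] ..
    finally have "N +>\<^bsub>M\<^esub> (a \<odot>\<^bsub>M\<^esub> m \<oplus>\<^bsub>M\<^esub> d \<odot>\<^bsub>M\<^esub> x) = \<phi> (a \<otimes> d)" .
    moreover have "a \<otimes> d \<in> I"
      using dm(2) p(2) by (rule I.I_l_closed)
    ultimately show "p \<otimes>\<^bsub>idealization R M\<^esub> q \<in> ?J"
      using am by (simp add: p(1) dm(1) triple_ideal_iff idealization_def)
  qed
qed

text \<open>On I the two sides agree by \<open>triple_ideal_fibre\<close>; outside I both are
  \<open>undefined\<close>, because homomorphisms are extensional. Recovering \<open>\<phi>\<close>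
  from its ideal yields both the uniqueness of the homomorphism and the injectivity of the
  correspondence.\<close>

lemma triple_hom_eq_fibre: "\<phi> = (\<lambda>d\<in>I. triple_ideal R M I N \<phi> `` {d})"
proof
  fix d
  show "\<phi> d = (\<lambda>d\<in>I. triple_ideal R M I N \<phi> `` {d}) d"
    using \<phi> triple_ideal_fibre[of d]
    by (cases "d \<in> I") (auto simp: module_hom_def ideal_module_def)
qed

end

section \<open>The bijection between triples and ideals\<close>

lemma bij_betw_triple_ideal:
  "bij_betw (\<lambda>(I, N, \<phi>). triple_ideal R M I N \<phi>)
    (ideal_triples R M) {J. ideal J (idealization R M)}"
proof (rule bij_betw_byWitness)
  \<comment> \<open>The inverse map reads the projection, the fibre over 0 and the fibre map off the
    ideal. The lemmas on triples recover each of the three components, and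
    \<open>ideal_eq_triple_ideal_fibre\<close> recovers the ideal.\<close>
  let ?g = "\<lambda>J. (fst ` J, {m \<in> carrier M. (\<zero>, m) \<in> J}, \<lambda>d\<in>fst ` J. J `` {d})"
  show "\<forall>t\<in>ideal_triples R M. ?g (case t of (I, N, \<phi>) \<Rightarrow> triple_ideal R M I N \<phi>) = t"
  proof
    fix t assume "t \<in> ideal_triples R M"
    then obtain I N \<phi> where t: "t = (I, N, \<phi>)" and "ideal I R" "submodule N R M"
        "ideal_smult R M I \<subseteq> N" "\<phi> \<in> module_hom R (ideal_module R I) (quot_module M N)"
      by (auto simp: ideal_triples_def)
    note * = this(2-)
    show "?g (case t of (I, N, \<phi>) \<Rightarrow> triple_ideal R M I N \<phi>) = t"
      unfolding t prod.case fst_triple_ideal[OF *] triple_ideal_zero_fibre[OF *]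
        triple_hom_eq_fibre[OF *, symmetric] by (rule refl)
  qed
  show "\<forall>J\<in>{J. ideal J (idealization R M)}.
      (case ?g J of (I, N, \<phi>) \<Rightarrow> triple_ideal R M I N \<phi>) = J"
    unfolding prod.case using ideal_eq_triple_ideal_fibre[symmetric] by blast
  show "(\<lambda>(I, N, \<phi>). triple_ideal R M I N \<phi>) ` ideal_triples R M
      \<subseteq> {J. ideal J (idealization R M)}"
    by (auto simp: ideal_triples_def ideal_triple_ideal)
  show "?g ` {J. ideal J (idealization R M)} \<subseteq> ideal_triples R M"
    unfolding ideal_triples_def
    using ideal_fst_image submodule_zero_fibre ideal_smult_fst_image_subset fibre_in_module_hom
    by blast
qed

end

theorem theorem2p1:
  fixes D :: "('a, 'c) ring_scheme" and M :: "('a, 'b, 'd) module_scheme"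
  assumes "cring D" and "module D M"
  shows
    "(\<forall>J. ideal J (idealization D M) \<longrightarrow>
        (let I = fst ` J; N = {m \<in> carrier M. (\<zero>\<^bsub>D\<^esub>, m) \<in> J} in
          ideal I D \<and> submodule N D M \<and> ideal_smult D M I \<subseteq> N \<and>
          (\<exists>!\<phi>. \<phi> \<in> module_hom D (ideal_module D I) (quot_module M N) \<and>
            J = triple_ideal D M I N \<phi>)))
     \<and> (\<forall>I N \<phi>. ideal I D \<and> submodule N D M \<and> ideal_smult D M I \<subseteq> N \<and>
          \<phi> \<in> module_hom D (ideal_module D I) (quot_module M N) \<longrightarrow>
          ideal (triple_ideal D M I N \<phi>) (idealization D M) \<and>
          fst ` triple_ideal D M I N \<phi> = I)
     \<and> bij_betw (\<lambda>(I, N, \<phi>). triple_ideal D M I N \<phi>)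
          (ideal_triples D M) {J. ideal J (idealization D M)}"
proof -
  interpret module D M by fact
  have unique_hom: "\<exists>!\<phi>. \<phi> \<in> module_hom D (ideal_module D (fst ` J))
        (quot_module M {m \<in> carrier M. (\<zero>\<^bsub>D\<^esub>, m) \<in> J}) \<and>
      J = triple_ideal D M (fst ` J) {m \<in> carrier M. (\<zero>\<^bsub>D\<^esub>, m) \<in> J} \<phi>"
    if J: "ideal J (idealization D M)" for J
  proof (intro ex1I conjI)
    show "(\<lambda>d\<in>fst ` J. J `` {d}) \<in> module_hom D (ideal_module D (fst ` J))
        (quot_module M {m \<in> carrier M. (\<zero>\<^bsub>D\<^esub>, m) \<in> J})"
      by (rule fibre_in_module_hom[OF J])
    show "J = triple_ideal D M (fst ` J) {m \<in> carrier M. (\<zero>\<^bsub>D\<^esub>, m) \<in> J} (\<lambda>d\<in>fst ` J. J `` {d})"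
      by (rule ideal_eq_triple_ideal_fibre[OF J])
  next
    fix \<psi>
    assume \<psi>: "\<psi> \<in> module_hom D (ideal_module D (fst ` J))
          (quot_module M {m \<in> carrier M. (\<zero>\<^bsub>D\<^esub>, m) \<in> J}) \<and>
        J = triple_ideal D M (fst ` J) {m \<in> carrier M. (\<zero>\<^bsub>D\<^esub>, m) \<in> J} \<psi>"
    \<comment> \<open>Any competitor \<open>\<psi>\<close> is the fibre map of the ideal that it
      defines, and by assumption this ideal is J.\<close>
    show "\<psi> = (\<lambda>d\<in>fst ` J. J `` {d})"
      using triple_hom_eq_fibre[OF ideal_fst_image[OF J] submodule_zero_fibre[OF J]
          ideal_smult_fst_image_subset[OF J] conjunct1[OF \<psi>]]
      unfolding conjunct2[OF \<psi>, symmetric] .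
  qed
  show ?thesis
    unfolding Let_def
  proof (intro conjI allI impI; (elim conjE)?)
    fix J assume J: "ideal J (idealization D M)"
    show "ideal (fst ` J) D"
      by (rule ideal_fst_image[OF J])
    show "submodule {m \<in> carrier M. (\<zero>\<^bsub>D\<^esub>, m) \<in> J} D M"
      by (rule submodule_zero_fibre[OF J])
    show "ideal_smult D M (fst ` J) \<subseteq> {m \<in> carrier M. (\<zero>\<^bsub>D\<^esub>, m) \<in> J}"
      by (rule ideal_smult_fst_image_subset[OF J])
    show "\<exists>!\<phi>. \<phi> \<in> module_hom D (ideal_module D (fst ` J))
          (quot_module M {m \<in> carrier M. (\<zero>\<^bsub>D\<^esub>, m) \<in> J}) \<and>
        J = triple_ideal D M (fst ` J) {m \<in> carrier M. (\<zero>\<^bsub>D\<^esub>, m) \<in> J} \<phi>"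
      by (rule unique_hom[OF J])
  qed (rule ideal_triple_ideal fst_triple_ideal bij_betw_triple_ideal; assumption)+
qed

end
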